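(* We have $$\frac{1-t}{1-t\,\mathrm{Exp}_{q}(yx)\exp_{q}(x)}=1+\sum_{n=1}^{\infty}\frac{(1+yt)^{n+1}}{(1+y)(1-t)^{n}}P_{n}^{(\mathrm{inv},\mathrm{pk},\mathrm{des})}\left(q,\frac{(1+y)^{2}t}{(y+t)(1+yt)},\frac{y+t}{1+yt}\right)\frac{x^{n}}{[n]_{q}!}.$$ Equivalently, $$\sum_{n=1}^{\infty}P_{n}^{(\mathrm{inv},\mathrm{pk},\mathrm{des})}(q,y,t)\frac{x^{n}}{[n]_{q}!}=\frac{v(1+u)}{1+uv}\cdot\frac{\mathrm{Exp}_{q}\left(\frac{u(1-v)}{1+uv}x\right)\exp_{q}\left(\frac{1-v}{1+uv}x\right)-1}{1-v\,\mathrm{Exp}_{q}\left(\frac{u(1-v)}{1+uv}x\right)\exp_{q}\left(\frac{1-v}{1+uv}x\right)},$$ where $$u=\frac{1+t^{2}-2yt-(1-t)\sqrt{(1+t)^{2}-4yt}}{2(1-y)t},\qquad v=\frac{(1+t)^{2}-2yt-(1+t)\sqrt{(1+t)^{2}-4yt}}{2yt}.$$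
   Context: $\mathfrak{S}_n$ is the set of permutations $\pi=\pi_1\cdots\pi_n$ of $[n]=\{1,\dots,n\}$. For $\pi\in\mathfrak{S}_n$: $\mathrm{des}(\pi)$ is the number of $i\in[n-1]$ with $\pi_i>\pi_{i+1}$; $\mathrm{pk}(\pi)$ is the number of $i$ with $2\le i\le n-1$ and $\pi_{i-1}<\pi_i>\pi_{i+1}$; $\mathrm{inv}(\pi)$ is the number of pairs $(i,j)$ with $1\le i<j\le n$ and $\pi_i>\pi_j$. For $n\ge 1$, $P_n^{(\mathrm{inv},\mathrm{pk},\mathrm{des})}(q,y,t)=\sum_{\pi\in\mathfrak{S}_n}q^{\mathrm{inv}(\pi)}y^{\mathrm{pk}(\pi)+1}t^{\mathrm{des}(\pi)+1}$. Also $[n]_q!=(1+q)(1+q+q^2)\cdots(1+q+\cdots+q^{n-1})$ (with $[0]_q!=[1]_q!=1$), $\exp_q(x)=\sum_{n\ge0}\frac{x^n}{[n]_q!}$ and $\mathrm{Exp}_q(x)=\sum_{n\ge0}q^{\binom n2}\frac{x^n}{[n]_q!}$. Here $q,y,t,x$ are indeterminates and the identities are identities of formal power series in $x$: in the first, coefficients are rational functions of $q,y,t$; in the second, coefficients are formal power series in $t$ over $\mathbb{Q}(q)[y]$, where $\sqrt{(1+t)^2-4yt}$ is the power series in $t$ over $\mathbb{Q}[y]$ with constant term $1$, so that $u,v$ are formal power series in $t$ over $\mathbb{Q}[y]$. *)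

theory Defs
  imports
    "HOL-Computational_Algebra.Computational_Algebra"
    "HOL-Combinatorics.Permutations"
begin

section \<open>Permutation statistics\<close>

text \<open>A permutation of $[n]$ is a function \<open>\<pi> :: nat \<Rightarrow> nat\<close> with \<open>\<pi> permutes {1..n}\<close>.\<close>

definition des :: "nat \<Rightarrow> (nat \<Rightarrow> nat) \<Rightarrow> nat" where
  "des n \<pi> = card {i \<in> {1..n - 1}. \<pi> i > \<pi> (i + 1)}"

definition pk :: "nat \<Rightarrow> (nat \<Rightarrow> nat) \<Rightarrow> nat" where
  "pk n \<pi> = card {i \<in> {2..n - 1}. \<pi> (i - 1) < \<pi> i \<and> \<pi> i > \<pi> (i + 1)}"

definition inv_stat :: "nat \<Rightarrow> (nat \<Rightarrow> nat) \<Rightarrow> nat" where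
  "inv_stat n \<pi> = card {(i, j). 1 \<le> i \<and> i < j \<and> j \<le> n \<and> \<pi> i > \<pi> j}"

definition P_inv_pk_des :: "nat \<Rightarrow> 'a::comm_semiring_1 \<Rightarrow> 'a \<Rightarrow> 'a \<Rightarrow> 'a" where
  "P_inv_pk_des n q y t =
     (\<Sum>\<pi> | \<pi> permutes {1..n}. q ^ inv_stat n \<pi> * y ^ (pk n \<pi> + 1) * t ^ (des n \<pi> + 1))"


section \<open>The two $q$-exponential series\<close>

definition qfact :: "'a::comm_semiring_1 \<Rightarrow> nat \<Rightarrow> 'a" where
  "qfact q n = (\<Prod>k=1..n. \<Sum>i<k. q ^ i)"

definition exp_q :: "'a::field \<Rightarrow> 'a fps" where
  "exp_q q = Abs_fps (\<lambda>n. 1 / qfact q n)"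

definition Exp_q :: "'a::field \<Rightarrow> 'a fps" where
  "Exp_q q = Abs_fps (\<lambda>n. q ^ (n choose 2) / qfact q n)"


section \<open>Exact division and square roots in domains of power series\<close>

text \<open>
  Power series over a polynomial ring have no library division. The quotient below is the
  mathematical one: the unique \<open>c\<close> with \<open>c * b = a\<close>. It is only meaningful when \<open>b\<close> is
  nonzero and divides \<open>a\<close>; that this holds for every quotient formed with it is proved at the
  end of this theory.
\<close>

definition exact_div :: "'a::idom \<Rightarrow> 'a \<Rightarrow> 'a" (infixl \<open>\<div>\<close> 70) where
  "a \<div> b = (THE c. c * b = a)"

lemma exact_div_eqI:
  fixes a b c :: "'a::idom"
  assumes "b \<noteq> 0" "c * b = a"
  shows "a \<div> b = c"
  unfolding exact_div_def using assms by (intro the_equality) auto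

lemma exact_div_mult:
  fixes a b :: "'a::idom"
  assumes "b \<noteq> 0" "b dvd a"
  shows "(a \<div> b) * b = a"
  using assms exact_div_eqI by (metis dvd_def mult.commute)

definition fps_sqrt_one :: "'a::idom fps \<Rightarrow> 'a fps" where
  "fps_sqrt_one f = (THE s. s ^ 2 = f \<and> fps_nth s 0 = 1)"


section \<open>Coefficient rings\<close>

text \<open>\<open>\<rat>(q,y,t)\<close>, as the fraction field of \<open>\<rat>[q][y][t]\<close>.\<close>

type_synonym rat_qyt = "rat poly poly poly fract"

definition q_rat :: rat_qyt where "q_rat = to_fract [:[:[:0, 1:]:]:]"
definition y_rat :: rat_qyt where "y_rat = to_fract [:[:0, 1:]:]"
definition t_rat :: rat_qyt where "t_rat = to_fract [:0, 1:]"

text \<open>\<open>\<rat>(q)[y][[t]]\<close>.\<close>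

type_synonym rat_q = "rat poly fract"
type_synonym ser_t = "rat_q poly fps"

definition q_rat_q :: rat_q where "q_rat_q = to_fract [:0, 1:]"
definition y_ser :: ser_t where "y_ser = fps_const [:0, 1:]"
definition t_ser :: ser_t where "t_ser = fps_X"

definition of_rat_q :: "rat_q \<Rightarrow> ser_t" where "of_rat_q c = fps_const [:c:]"

definition fps_map :: "('a::zero \<Rightarrow> 'b::zero) \<Rightarrow> 'a fps \<Rightarrow> 'b fps" where
  "fps_map h f = Abs_fps (\<lambda>n. h (fps_nth f n))"

definition root_ser :: ser_t where
  "root_ser = fps_sqrt_one ((1 + t_ser) ^ 2 - 4 * y_ser * t_ser)"

definition u_ser :: ser_t where
  "u_ser = (1 + t_ser ^ 2 - 2 * y_ser * t_ser - (1 - t_ser) * root_ser)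
           \<div> (2 * (1 - y_ser) * t_ser)"

definition v_ser :: ser_t where
  "v_ser = ((1 + t_ser) ^ 2 - 2 * y_ser * t_ser - (1 + t_ser) * root_ser)
           \<div> (2 * y_ser * t_ser)"


section \<open>The square root and the quotients are well defined\<close>

lemma fps_square_unique:
  fixes s s' :: "'a::{idom,ring_char_0} fps"
  assumes "s ^ 2 = s' ^ 2" "fps_nth s 0 = 1" "fps_nth s' 0 = 1"
  shows "s = s'"
proof -
  have "(s - s') * (s + s') = 0"
    using assms(1) by (simp add: algebra_simps power2_eq_square)
  moreover have "fps_nth (s + s') 0 \<noteq> 0"
    using assms by simp
  then have "s + s' \<noteq> 0"
    by (metis fps_zero_nth)
  ultimately show ?thesis by simp
qed

fun sqrt_coeff :: "'a::comm_ring_1 \<Rightarrow> (nat \<Rightarrow> 'a) \<Rightarrow> nat \<Rightarrow> 'a" where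
  "sqrt_coeff h a 0 = 1"
| "sqrt_coeff h a (Suc n) =
     h * (a (Suc n) - (\<Sum>i\<in>{1..n}. if 1 \<le> i \<and> i \<le> n then sqrt_coeff h a i * sqrt_coeff h a (Suc n - i) else 0))"

declare sqrt_coeff.simps(2) [simp del]

lemma fps_square_exists:
  fixes f :: "'a::comm_ring_1 fps"
  assumes f0: "fps_nth f 0 = 1" and h: "2 * (h :: 'a) = 1"
  shows "\<exists>s. s ^ 2 = f \<and> fps_nth s 0 = 1"
proof (intro exI conjI)
  define c where "c = sqrt_coeff h (fps_nth f)"
  show "fps_nth (Abs_fps c) 0 = 1" by (simp add: c_def)
  have c0: "c 0 = 1" by (simp add: c_def)
  show "(Abs_fps c) ^ 2 = f"
  proof (rule fps_ext)
    fix n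
    show "fps_nth ((Abs_fps c) ^ 2) n = fps_nth f n"
    proof (cases n)
      case 0
      then show ?thesis using f0 by (simp add: power2_eq_square fps_mult_nth c0)
    next
      case (Suc m)
      have cS: "c (Suc m) = h * (fps_nth f (Suc m) - (\<Sum>i\<in>{1..m}. c i * c (Suc m - i)))"
        unfolding c_def by (subst sqrt_coeff.simps) (auto intro!: arg_cong[where f="\<lambda>x. h * (_ - x)"] sum.cong)
      have "{0..Suc m} = insert 0 (insert (Suc m) {1..m})" by auto
      then have "fps_nth ((Abs_fps c) ^ 2) n = 2 * c (Suc m) + (\<Sum>i\<in>{1..m}. c i * c (Suc m - i))"
        using Suc by (simp add: power2_eq_square fps_mult_nth c0)
      also have "2 * c (Suc m) = (2 * h) * (fps_nth f (Suc m) - (\<Sum>i\<in>{1..m}. c i * c (Suc m - i)))"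
        unfolding cS by (simp only: mult.assoc)
      finally show ?thesis using Suc h by simp
    qed
  qed
qed

lemma root_ser: "root_ser ^ 2 = (1 + t_ser) ^ 2 - 4 * y_ser * t_ser" "fps_nth root_ser 0 = 1"
proof -
  let ?f = "(1 + t_ser) ^ 2 - 4 * y_ser * t_ser"
  have f0: "fps_nth ?f 0 = 1"
    by (simp add: t_ser_def power2_eq_square)
  have h: "2 * [:1/2 :: rat_q:] = 1"
    by (simp add: numeral_poly one_pCons)
  obtain s where s: "s ^ 2 = ?f" "fps_nth s 0 = 1"
    using fps_square_exists[OF f0 h] by blast
  have "root_ser = s"
    unfolding root_ser_def fps_sqrt_one_def
    using s by (intro the_equality) (auto intro: fps_square_unique)
  with s show "root_ser ^ 2 = ?f" "fps_nth root_ser 0 = 1" by auto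
qed

lemma fps_const_dvdI:
  fixes f :: "'a::comm_ring_1 fps"
  assumes "\<And>n. c dvd fps_nth f n"
  shows "fps_const c dvd f"
proof -
  obtain g where g: "\<And>n. fps_nth f n = c * g n"
    using assms unfolding dvd_def by metis
  have "f = fps_const c * Abs_fps g"
    by (rule fps_ext) (simp add: g)
  then show ?thesis by simp
qed

text \<open>Evaluating \<open>y\<close> at a constant, coefficientwise in \<open>t\<close>.\<close>

abbreviation eval_y :: "rat_q \<Rightarrow> ser_t \<Rightarrow> rat_q fps" where
  "eval_y a \<equiv> fps_map (\<lambda>p. poly p a)"

lemma eval_y_simps:
  "eval_y a (f + g) = eval_y a f + eval_y a g"
  "eval_y a (f - g) = eval_y a f - eval_y a g"
  "eval_y a (f * g) = eval_y a f * eval_y a g"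
  "eval_y a (f ^ k) = eval_y a f ^ k"
  "eval_y a 1 = 1"
  "eval_y a (numeral m) = numeral m"
  "eval_y a t_ser = fps_X"
  "eval_y a y_ser = fps_const a"
proof -
  have mult: "eval_y a (f * g) = eval_y a f * eval_y a g" for f g
    by (rule fps_ext) (simp add: fps_map_def fps_mult_nth poly_sum)
  have one: "eval_y a 1 = 1"
    by (rule fps_ext) (simp add: fps_map_def fps_one_nth)
  show "eval_y a (f * g) = eval_y a f * eval_y a g" by (rule mult)
  show "eval_y a 1 = 1" by (rule one)
  show "eval_y a (f ^ k) = eval_y a f ^ k"
    by (induction k) (simp_all add: mult one)
  show "eval_y a (f + g) = eval_y a f + eval_y a g"
       "eval_y a (f - g) = eval_y a f - eval_y a g"
       "eval_y a (numeral m) = numeral m"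
       "eval_y a t_ser = fps_X"
       "eval_y a y_ser = fps_const a"
    by (rule fps_ext; simp add: fps_map_def t_ser_def y_ser_def numeral_fps_const)+
qed

lemma linear_dvdI:
  assumes "eval_y a f = 0"
  shows "fps_const [:- a, 1:] dvd f"
proof (rule fps_const_dvdI)
  fix n
  have "poly (fps_nth f n) a = 0"
    using arg_cong[OF assms, of "\<lambda>g. fps_nth g n"] by (simp add: fps_map_def)
  then show "[:- a, 1:] dvd fps_nth f n" by (simp add: poly_eq_0_iff_dvd)
qed

lemma eval_y_root:
  assumes "(eval_y a ((1 + t_ser) ^ 2 - 4 * y_ser * t_ser)) = w ^ 2" "fps_nth w 0 = 1"
  shows "eval_y a root_ser = w"
proof (rule fps_square_unique)
  show "eval_y a root_ser ^ 2 = w ^ 2"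
    using assms(1) root_ser(1) by (metis eval_y_simps(4))
  show "fps_nth (eval_y a root_ser) 0 = 1"
    by (simp add: fps_map_def root_ser(2))
qed (fact assms(2))

lemma two_const_t_dvdI:
  fixes f :: ser_t
  assumes "fps_const c dvd f" "fps_nth f 0 = 0" "c \<noteq> 0"
  shows "2 * fps_const c * t_ser dvd f"
proof -
  obtain g where g: "f = fps_const c * g" using assms(1) by (elim dvdE)
  then have "fps_nth g 0 = 0" using assms(2,3) by simp
  then have "g = fps_X * fps_shift 1 g"
    by (intro fps_ext) (auto simp: gr0_conv_Suc)
  moreover have "2 * fps_const [:1/2 :: rat_q:] = 1"
    by (rule fps_ext) (simp add: numeral_fps_const numeral_poly one_pCons)
  ultimately have "f = (2 * fps_const c * t_ser) * (fps_const [:1/2:] * fps_shift 1 g)"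
    unfolding g t_ser_def by (metis (no_types, lifting) mult.assoc mult.commute mult.left_commute mult_1)
  then show ?thesis by (metis dvd_triv_left)
qed

lemma u_ser:
  "u_ser * (2 * (1 - y_ser) * t_ser) = 1 + t_ser ^ 2 - 2 * y_ser * t_ser - (1 - t_ser) * root_ser"
proof -
  let ?f = "1 + t_ser ^ 2 - 2 * y_ser * t_ser - (1 - t_ser) * root_ser"
  have w: "eval_y 1 root_ser = 1 - fps_X"
    by (rule eval_y_root) (simp_all add: eval_y_simps power2_eq_square algebra_simps)
  have "eval_y 1 ?f = 0"
    by (simp add: eval_y_simps w power2_eq_square algebra_simps)
  then have "fps_const [:-1, 1:] dvd ?f" by (rule linear_dvdI)
  then have "- fps_const [:-1, 1:] dvd ?f" by (simp only: minus_dvd_iff)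
  then have d: "fps_const [:1, -1:] dvd ?f" by (simp add: fps_const_neg)
  have f0: "fps_nth ?f 0 = 0"
    by (simp add: t_ser_def root_ser(2))
  have c: "1 - y_ser = fps_const [:1, -1:]"
    by (simp add: y_ser_def one_pCons flip: fps_const_1_eq_1 fps_const_sub)
  have "2 * (1 - y_ser) * t_ser dvd ?f"
    unfolding c by (rule two_const_t_dvdI[OF d f0]) simp
  moreover have "2 * (1 - y_ser) * t_ser \<noteq> 0"
    unfolding c by (simp add: t_ser_def)
  ultimately show ?thesis
    unfolding u_ser_def by (intro exact_div_mult)
qed

lemma v_ser:
  "v_ser * (2 * y_ser * t_ser) = (1 + t_ser) ^ 2 - 2 * y_ser * t_ser - (1 + t_ser) * root_ser"
proof -
  let ?f = "(1 + t_ser) ^ 2 - 2 * y_ser * t_ser - (1 + t_ser) * root_ser"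
  have w: "eval_y 0 root_ser = 1 + fps_X"
    by (rule eval_y_root) (simp_all add: eval_y_simps)
  have "eval_y 0 ?f = 0"
    by (simp add: eval_y_simps w power2_eq_square algebra_simps)
  then have d: "fps_const [:0, 1:] dvd ?f" using linear_dvdI[of 0] by simp
  have f0: "fps_nth ?f 0 = 0"
    by (simp add: t_ser_def root_ser(2) power2_eq_square)
  have "2 * y_ser * t_ser dvd ?f"
    unfolding y_ser_def by (rule two_const_t_dvdI[OF d[unfolded y_ser_def] f0[unfolded y_ser_def]]) simp
  moreover have "2 * y_ser * t_ser \<noteq> 0"
    by (simp add: t_ser_def y_ser_def)
  ultimately show ?thesis
    unfolding v_ser_def by (intro exact_div_mult)
qed

lemma fps_exact_div_mult:
  fixes a b :: "'a::idom fps"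
  assumes "fps_nth b 0 dvd 1"
  shows "(a \<div> b) * b = a"
proof -
  obtain c where c: "fps_nth b 0 * c = 1" using assms by (metis dvdE)
  then have "b * fps_right_inverse b c = 1" by (rule fps_right_inverse)
  then have "b dvd 1" by (metis dvd_triv_left)
  then have "b dvd a" "b \<noteq> 0" by (auto intro: dvd_trans)
  then show ?thesis by (intro exact_div_mult)
qed

lemma fps_nth_v_ser_0: "fps_nth v_ser 0 = 0"
proof -
  define r where "r = fps_nth root_ser 1"
  have "fps_nth (v_ser * (2 * y_ser * t_ser)) 1 = fps_nth v_ser 0 * (2 * [:0, 1:])"
    unfolding t_ser_def y_ser_def numeral_fps_const
    by (simp add: fps_mult_nth)
  moreover have "fps_nth ((1 + t_ser) ^ 2 - 2 * y_ser * t_ser - (1 + t_ser) * root_ser) 1 =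
      2 - 2 * [:0, 1:] - (r + 1)"
    using root_ser(2) unfolding t_ser_def y_ser_def numeral_fps_const r_def
    by (simp add: power2_eq_square fps_mult_nth)
  ultimately have 1: "fps_nth v_ser 0 * (2 * [:0, 1:]) = 2 - 2 * [:0, 1:] - (r + 1)"
    by (simp only: v_ser)
  have "fps_nth (root_ser ^ 2) 1 = 2 * r"
    using root_ser(2) unfolding r_def by (simp add: power2_eq_square fps_mult_nth)
  moreover have "fps_nth ((1 + t_ser) ^ 2 - 4 * y_ser * t_ser) 1 = 2 - 4 * [:0, 1:]"
    unfolding t_ser_def y_ser_def numeral_fps_const
    by (simp add: power2_eq_square fps_mult_nth)
  ultimately have 2: "2 * r = 2 - 4 * [:0, 1:]"
    by (simp only: root_ser(1))
  have "2 * (fps_nth v_ser 0 * (2 * [:0, 1:])) = 0"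
    unfolding 1 using 2 by (simp only: algebra_simps)
  then show ?thesis by simp
qed

lemma exact_div_one_plus_uv: "(a \<div> (1 + u_ser * v_ser)) * (1 + u_ser * v_ser) = a"
  by (rule fps_exact_div_mult) (simp add: fps_nth_v_ser_0)

lemma exact_div_one_minus_v_mult:
  fixes a F :: "ser_t fps"
  assumes "fps_nth F 0 = 1"
  shows "(a \<div> (1 - fps_const v_ser * F)) * (1 - fps_const v_ser * F) = a"
proof (rule fps_exact_div_mult)
  have "(1 \<div> (1 - v_ser)) * (1 - v_ser) = 1"
    by (rule fps_exact_div_mult) (simp add: fps_nth_v_ser_0)
  then show "fps_nth (1 - fps_const v_ser * F) 0 dvd 1"
    using assms by (simp, metis dvd_triv_right)
qed

end

theory Submission
  imports Defs "HOL-Combinatorics.Multiset_Permutations"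
begin

text \<open>
  Cutting permutations of \<open>m + n\<close> after position \<open>m\<close> shows that the \<open>inv\<close>-weighted sums over
  permutations, divided by \<open>[n]\<^sub>q!\<close>, multiply by splitting descent words at an arbitrary letter.
  Every weight on descent words thus gives a power series, and products of series become
  convolutions of weights; \<open>exp\<^sub>q\<close> and \<open>Exp\<^sub>q\<close> come from the all-ascent and the all-descent words.
  With \<open>F = Exp\<^sub>q(yx) exp\<^sub>q(x)\<close>, the equation \<open>T (1 - v F) = F - 1\<close> is therefore an identity between
  weights on words, solved by a multiplicative weight that depends only on the pairs of
  consecutive letters.  The multiplicities of these pairs are determined by the length, \<open>pk\<close> and
  \<open>des\<close>.  Both identities are instances, the second one because \<open>u\<close> and \<open>v\<close> satisfy
  \<open>u + v = (1 + u v) t\<close> and \<open>v (1 + u)\<^sup>2 = (1 + u v)\<^sup>2 y t\<close>.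
\<close>

section \<open>Inversions and descent words\<close>

fun descents :: "nat list \<Rightarrow> bool list" where
  "descents (x # y # zs) = (x > y) # descents (y # zs)"
| "descents _ = []"

primrec inversions :: "nat list \<Rightarrow> nat" where
  "inversions [] = 0"
| "inversions (x # xs) = card {y \<in> set xs. y < x} + inversions xs"

text \<open>Counts the inversions between a block with entries \<open>A\<close> and a later block
  with entries \<open>B\<close>. Only the two sets matter, so it factors out of a sum over their
  arrangements.\<close>

definition cross :: "nat set \<Rightarrow> nat set \<Rightarrow> nat" where
  "cross A B = (\<Sum>x\<in>A. card {y \<in> B. y < x})"

lemma length_descents [simp]: "length (descents xs) = length xs - 1"
  by (induction xs rule: descents.induct) auto

lemma descents_append:
  "xs \<noteq> [] \<Longrightarrow> ys \<noteq> [] \<Longrightarrow> descents (xs @ ys) = descents xs @ (last xs > hd ys) # descents ys"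
proof (induction xs rule: descents.induct)
  case ("2_2" v)
  then show ?case by (cases ys) auto
qed auto

lemma descents_take: "0 < n \<Longrightarrow> n \<le> length xs \<Longrightarrow> descents (take n xs) = take (n - 1) (descents xs)"
proof (induction xs arbitrary: n rule: descents.induct)
  case (1 x y zs)
  show ?case
  proof (cases "n = 1")
    case False
    then obtain k where "n = Suc (Suc k)" using 1(2) by (metis One_nat_def not0_implies_Suc not_gr_zero)
    then show ?thesis using 1(1)[of "Suc k"] 1(3) by simp
  qed simp
qed (auto simp: take_Cons')

lemma descents_drop: "n < length xs \<Longrightarrow> descents (drop n xs) = drop n (descents xs)"
proof (induction xs arbitrary: n rule: descents.induct)
  case (1 x y zs)
  then show ?case by (cases n) auto
qed (auto simp: drop_Cons')

lemma inversions_append: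
  assumes "distinct (xs @ ys)"
  shows "inversions (xs @ ys) = inversions xs + inversions ys + cross (set xs) (set ys)"
  using assms
proof (induction xs)
  case (Cons x xs)
  have "{y \<in> set xs \<union> set ys. y < x} = {y \<in> set xs. y < x} \<union> {y \<in> set ys. y < x}" by auto
  then have "card {y \<in> set xs \<union> set ys. y < x} = card {y \<in> set xs. y < x} + card {y \<in> set ys. y < x}"
    using Cons.prems by (subst card_Un_disjoint[symmetric]) auto
  then show ?case using Cons by (simp add: cross_def)
qed (simp add: cross_def)

lemma inversions_map:
  assumes "strict_mono_on A h" "set xs \<subseteq> A"
  shows "inversions (map h xs) = inversions xs"
  using assms(2)
proof (induction xs)
  case (Cons x xs)
  have "inj_on h A" using assms(1) by (rule strict_mono_on_imp_inj_on)
  have "{y \<in> h ` set xs. y < h x} = h ` {y \<in> set xs. y < x}"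
    using Cons.prems assms(1) by (auto simp: strict_mono_on_less)
  then have "card {y \<in> h ` set xs. y < h x} = card {y \<in> set xs. y < x}"
    using Cons.prems by (auto intro!: card_image inj_on_subset[OF \<open>inj_on h A\<close>])
  then show ?case using Cons by simp
qed simp

lemma descents_map:
  assumes "strict_mono_on A h" "set xs \<subseteq> A"
  shows "descents (map h xs) = descents xs"
  using assms(2) by (induction xs rule: descents.induct) (auto simp: strict_mono_on_less[OF assms(1)])

section \<open>Cutting permutations, and q-factorials\<close>

definition inv_sum :: "'a::comm_ring_1 \<Rightarrow> nat \<Rightarrow> (bool list \<Rightarrow> 'a) \<Rightarrow> 'a" where
  "inv_sum q n f = (\<Sum>xs\<in>permutations_of_set {..<n}. q ^ inversions xs * f (descents xs))"

text \<open>Inversions and descents depend only on relative order, so the increasing bijection from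
  \<open>{..<card A}\<close> onto \<open>A\<close> transports the sum.\<close>

lemma sum_permutations_relabel:
  assumes "finite A"
  shows "(\<Sum>xs\<in>permutations_of_set A. q ^ inversions xs * f (descents xs)) = inv_sum q (card A) f"
proof -
  obtain h where h: "bij_betw h {..<card A} A" "strict_mono_on {..<card A} h"
    using ex_bij_betw_strict_mono_card[OF assms] by blast
  have inj: "inj_on h {..<card A}" and im: "h ` {..<card A} = A" using h(1) by (auto simp: bij_betw_def)
  have "bij_betw (map h) (permutations_of_set {..<card A}) (permutations_of_set A)"
    unfolding bij_betw_def
  proof
    show "inj_on (map h) (permutations_of_set {..<card A})"
      by (intro inj_onI) (use inj in \<open>auto simp: permutations_of_set_def inj_on_map_eq_map\<close>)
    show "map h ` permutations_of_set {..<card A} = permutations_of_set A"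
      using permutations_of_set_image_inj[OF inj] im by simp
  qed
  from sum.reindex_bij_betw[OF this, of "\<lambda>xs. q ^ inversions xs * f (descents xs)"]
  have "(\<Sum>xs\<in>permutations_of_set A. q ^ inversions xs * f (descents xs)) =
      (\<Sum>xs\<in>permutations_of_set {..<card A}. q ^ inversions (map h xs) * f (descents (map h xs)))"
    by (rule sym)
  also have "\<dots> = inv_sum q (card A) f"
    unfolding inv_sum_def
    by (intro sum.cong refl) (simp add: permutations_of_set_def inversions_map[OF h(2)] descents_map[OF h(2)])
  finally show ?thesis .
qed

lemma set_drop_distinct:
  assumes "distinct xs"
  shows "set (drop n xs) = set xs - set (take n xs)"
proof -
  have "set (take n xs) \<union> set (drop n xs) = set xs"
    by (metis append_take_drop_id set_append)
  moreover have "set (take n xs) \<inter> set (drop n xs) = {}"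
    using assms by (simp add: set_take_disj_set_drop_if_distinct)
  ultimately show ?thesis by blast
qed

text \<open>A list is determined by the set \<open>S\<close> of its first \<open>n\<close> entries
  and an arrangement on each side of the cut; the inversions across the cut depend on
  \<open>S\<close> alone.\<close>

lemma sum_permutations_split:
  fixes q :: "'a::comm_ring_1"
  assumes "finite A" "n \<le> card A"
  shows "(\<Sum>xs\<in>permutations_of_set A. q ^ inversions xs * (f (take n xs) * g (drop n xs))) =
         (\<Sum>S | S \<subseteq> A \<and> card S = n. q ^ cross S (A - S) *
            ((\<Sum>xs\<in>permutations_of_set S. q ^ inversions xs * f xs) *
             (\<Sum>xs\<in>permutations_of_set (A - S). q ^ inversions xs * g xs)))"
    (is "?L = ?R")
proof -
  let ?P = "SIGMA S:{S. S \<subseteq> A \<and> card S = n}. permutations_of_set S \<times> permutations_of_set (A - S)"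
  have fin: "finite {S. S \<subseteq> A \<and> card S = n}" using assms(1) by simp
  have "?L = (\<Sum>(S, ys, zs)\<in>?P. q ^ cross S (A - S) * ((q ^ inversions ys * f ys) * (q ^ inversions zs * g zs)))"
  proof (rule sum.reindex_bij_witness[where i = "\<lambda>(S, ys, zs). ys @ zs"
        and j = "\<lambda>xs. (set (take n xs), take n xs, drop n xs)"], goal_cases)
    case (2 xs)
    then have xs: "set xs = A" "distinct xs" by (auto simp: permutations_of_set_def)
    then have "n \<le> length xs" using assms(2) distinct_card by metis
    then have "card (set (take n xs)) = n" using xs(2) by (simp add: distinct_card)
    moreover have "set (take n xs) \<subseteq> A" using xs(1) set_take_subset by metis
    ultimately show ?case
      using xs set_drop_distinct[OF xs(2), of n] by (simp add: permutations_of_set_def)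
  next
    case (3 p)
    then obtain S ys zs where p: "p = (S, ys, zs)" by (cases p) auto
    with 3 have "set ys = S" "length ys = n" by (auto simp: permutations_of_set_def distinct_card)
    then show ?case by (simp add: p)
  next
    case (4 p)
    then show ?case by (fastforce simp: permutations_of_set_def)
  next
    case (5 xs)
    then have xs: "set xs = A" "distinct xs" by (auto simp: permutations_of_set_def)
    have "inversions xs = inversions (take n xs) + inversions (drop n xs) + cross (set (take n xs)) (A - set (take n xs))"
      using inversions_append[of "take n xs" "drop n xs"] xs set_drop_distinct[OF xs(2), of n] by simp
    then show ?case by (simp add: power_add mult_ac)
  qed simp
  also have "\<dots> = (\<Sum>S | S \<subseteq> A \<and> card S = n. \<Sum>(ys, zs)\<in>permutations_of_set S \<times> permutations_of_set (A - S).
      q ^ cross S (A - S) * ((q ^ inversions ys * f ys) * (q ^ inversions zs * g zs)))"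
    by (subst sum.Sigma[OF fin]) simp_all
  also have "\<dots> = ?R"
    unfolding sum_product unfolding sum_distrib_left sum.cartesian_product case_prod_unfold ..
  finally show ?thesis .
qed

text \<open>Cut after the first entry: a first entry \<open>s\<close> has exactly \<open>s\<close>
  smaller entries behind it, and the rest is an arbitrary arrangement of \<open>n\<close> values.
  Summing over \<open>s\<close> gives the recursion of the q-factorial.\<close>

lemma inv_sum_one: "inv_sum q n (\<lambda>_. 1) = qfact q n"
proof (induction n)
  case 0
  then show ?case by (simp add: inv_sum_def qfact_def)
next
  case (Suc n)
  let ?A = "{..<Suc n}"
  have "inv_sum q (Suc n) (\<lambda>_. 1) =
     (\<Sum>S | S \<subseteq> ?A \<and> card S = 1. q ^ cross S (?A - S) *
            ((\<Sum>xs\<in>permutations_of_set S. q ^ inversions xs) *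
             (\<Sum>xs\<in>permutations_of_set (?A - S). q ^ inversions xs)))"
    using sum_permutations_split[of ?A 1 q "\<lambda>_. 1" "\<lambda>_. 1"] by (simp add: inv_sum_def)
  also have "\<dots> = (\<Sum>s<Suc n. q ^ s * qfact q n)"
  proof (rule sum.reindex_bij_witness[where i = "\<lambda>s. {s}" and j = the_elem], goal_cases)
    case (5 S)
    then obtain s where S: "S = {s}" "s < Suc n" by (auto simp: card_1_singleton_iff)
    have "{y. (y < Suc n \<and> y \<noteq> s) \<and> y < s} = {..<s}" using S by auto
    then have "cross S (?A - S) = s" using S by (simp add: cross_def)
    moreover have "(\<Sum>xs\<in>permutations_of_set (?A - S). q ^ inversions xs) = qfact q n"
      using sum_permutations_relabel[of "?A - S" q "\<lambda>_. 1"] S Suc by simp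
    ultimately show ?case using S by simp
  qed (auto simp: card_1_singleton_iff)
  also have "\<dots> = qfact q (Suc n)"
    by (simp add: qfact_def sum_distrib_right[symmetric] mult.commute)
  finally show ?case .
qed

text \<open>Letter \<open>m - 1\<close> of the descent word, counted from 0, is the step across the
  cut, and neither factor sees it. The form is free of division because the ring is
  arbitrary.\<close>

lemma inv_sum_mult:
  fixes q :: "'a::comm_ring_1"
  assumes "0 < m" "0 < n"
  shows "qfact q m * qfact q n * inv_sum q (m + n) (\<lambda>w. f (take (m - 1) w) * g (drop m w)) =
         qfact q (m + n) * (inv_sum q m f * inv_sum q n g)"
proof -
  \<comment> \<open>The Gaussian binomial coefficient; it depends neither on \<open>f\<close> nor on
    \<open>g\<close>.\<close>
  define X where "X = (\<Sum>S | S \<subseteq> {..<m+n} \<and> card S = m. q ^ cross S ({..<m+n} - S))"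
  have split: "inv_sum q (m + n) (\<lambda>w. f (take (m - 1) w) * g (drop m w)) = X * (inv_sum q m f * inv_sum q n g)"
    for f g :: "bool list \<Rightarrow> 'a"
  proof -
    have "inv_sum q (m + n) (\<lambda>w. f (take (m - 1) w) * g (drop m w)) =
      (\<Sum>xs\<in>permutations_of_set {..<m+n}. q ^ inversions xs *
          ((f \<circ> descents) (take m xs) * (g \<circ> descents) (drop m xs)))"
      unfolding inv_sum_def
    proof (intro sum.cong refl)
      fix xs :: "nat list" assume "xs \<in> permutations_of_set {..<m+n}"
      then have "length xs = m + n" 
        by (metis card_lessThan distinct_card permutations_of_setD(1) permutations_of_setD(2))
      then show "q ^ inversions xs * (f (take (m - 1) (descents xs)) * g (drop m (descents xs))) =
        q ^ inversions xs * ((f \<circ> descents) (take m xs) * (g \<circ> descents) (drop m xs))"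
        using assms by (simp add: descents_take descents_drop)
    qed
    also have "\<dots> = X * (inv_sum q m f * inv_sum q n g)"
      unfolding X_def sum_distrib_right
    proof (subst sum_permutations_split, simp, simp, intro sum.cong refl, goal_cases)
      case (1 S)
      then have "finite S" by (auto intro: finite_subset[of _ "{..<m+n}"])
      moreover have "card ({..<m+n} - S) = n" using 1 \<open>finite S\<close> by (simp add: card_Diff_subset)
      ultimately show ?case
        using 1 sum_permutations_relabel[of S q f] sum_permutations_relabel[of "{..<m+n} - S" q g]
        by simp
    qed
    finally show ?thesis .
  qed
  \<comment> \<open>Unit weights evaluate \<open>X\<close>, as all three sums become
    q-factorials.\<close>
  have "qfact q (m + n) = X * (qfact q m * qfact q n)"
    using split[of "\<lambda>_. 1" "\<lambda>_. 1"] by (simp add: inv_sum_one)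
  then show ?thesis unfolding split by (simp add: mult_ac)
qed

section \<open>Monotone words, the source of the two q-exponentials\<close>

lemma descents_all_False_iff: "True \<notin> set (descents xs) \<longleftrightarrow> sorted xs"
  by (induction xs rule: descents.induct) (auto simp: sorted_wrt1 sorted_wrt2 simp del: sorted_wrt.simps(2))

lemma descents_all_True_iff: "False \<notin> set (descents xs) \<longleftrightarrow> sorted_wrt (>) xs"
  by (induction xs rule: descents.induct) (auto simp: sorted_wrt1 sorted_wrt2 simp del: sorted_wrt.simps(2))

lemma inversions_sorted: "sorted xs \<Longrightarrow> inversions xs = 0"
  by (induction xs) (auto simp: card_eq_0_iff)

lemma inversions_decreasing: "sorted_wrt (>) xs \<Longrightarrow> inversions xs = length xs choose 2"
proof (induction xs)
  case (Cons x xs)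
  have "{y \<in> set xs. y < x} = set xs" using Cons.prems by auto
  moreover have "sorted_wrt (>) ys \<Longrightarrow> distinct ys" for ys :: "nat list"
    by (induction ys) auto
  ultimately show ?case using Cons by (simp add: distinct_card numeral_2_eq_2)
qed simp

text \<open>Only the increasing arrangement survives, and it has no inversions.\<close>

lemma inv_sum_ascending: "inv_sum q n (\<lambda>w. of_bool (True \<notin> set w)) = 1"
proof -
  have "xs = sorted_list_of_set {..<n}" if "set xs = {..<n}" "distinct xs" "sorted xs" for xs
    using that by (metis finite_lessThan sorted_distinct_set_unique distinct_sorted_list_of_set
        set_sorted_list_of_set sorted_sorted_list_of_set)
  then have *: "permutations_of_set {..<n} \<inter> {xs. sorted xs} = {sorted_list_of_set {..<n}}"
    by (auto simp: permutations_of_set_def)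
  have "inv_sum q n (\<lambda>w. of_bool (True \<notin> set w)) =
      (\<Sum>xs\<in>permutations_of_set {..<n}. if xs \<in> {xs. sorted xs} then q ^ inversions xs else 0)"
    unfolding inv_sum_def by (intro sum.cong) (auto simp: descents_all_False_iff)
  also have "\<dots> = (\<Sum>xs\<in>permutations_of_set {..<n} \<inter> {xs. sorted xs}. q ^ inversions xs)"
    by (subst sum.inter_restrict) auto
  finally show ?thesis unfolding * by (simp add: inversions_sorted)
qed

text \<open>Only the decreasing arrangement survives, and all its pairs are inversions.\<close>

lemma inv_sum_descending: "inv_sum q n (\<lambda>w. of_bool (False \<notin> set w)) = q ^ (n choose 2)"
proof -
  let ?d = "rev (sorted_list_of_set {..<n})"
  have dec: "sorted_wrt (>) ?d" by (simp add: sorted_wrt_rev)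
  have "xs = ?d" if "set xs = {..<n}" "distinct xs" "sorted_wrt (>) xs" for xs
  proof -
    have "sorted (rev xs)" using that(3) by (auto simp: sorted_wrt_rev elim!: sorted_wrt_mono_rel[rotated])
    then have "rev xs = sorted_list_of_set {..<n}"
      using that by (metis finite_lessThan sorted_distinct_set_unique distinct_sorted_list_of_set
        set_sorted_list_of_set sorted_sorted_list_of_set set_rev distinct_rev)
    then show ?thesis by (metis rev_rev_ident)
  qed
  then have *: "permutations_of_set {..<n} \<inter> {xs. sorted_wrt (>) xs} = {?d}"
    using dec by (auto simp: permutations_of_set_def)
  have "inv_sum q n (\<lambda>w. of_bool (False \<notin> set w)) =
      (\<Sum>xs\<in>permutations_of_set {..<n}. if xs \<in> {xs. sorted_wrt (>) xs} then q ^ inversions xs else 0)"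
    unfolding inv_sum_def by (intro sum.cong) (auto simp: descents_all_True_iff)
  also have "\<dots> = (\<Sum>xs\<in>permutations_of_set {..<n} \<inter> {xs. sorted_wrt (>) xs}. q ^ inversions xs)"
    by (subst sum.inter_restrict) auto
  finally show ?thesis unfolding * using inversions_decreasing[OF dec] by simp
qed

section \<open>Multiplicative weights on words\<close>

text \<open>The letter at position \<open>k\<close> is discarded, being the step across the cut. The
  word left on either side may be empty, but it still belongs to a nonempty block of
  entries.\<close>

definition conv :: "(bool list \<Rightarrow> 'a::comm_ring_1) \<Rightarrow> (bool list \<Rightarrow> 'a) \<Rightarrow> bool list \<Rightarrow> 'a" where
  "conv f g w = (\<Sum>k<length w. f (take k w) * g (drop (Suc k) w))"

lemma conv_simps [simp]:
  "conv f g [] = 0"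
  "conv f g (b # w) = f [] * g w + conv (\<lambda>u. f (b # u)) g w"
  by (simp_all add: conv_def sum.lessThan_Suc_shift del: sum.lessThan_Suc)

lemma conv_zero [simp]: "conv (\<lambda>_. 0) g w = 0"
  by (simp add: conv_def)

lemma conv_scale: "conv (\<lambda>u. a * f u) g w = a * conv f g w"
  by (simp add: conv_def sum_distrib_left mult.assoc)

text \<open>
  Words record the steps of a permutation, \<open>True\<close> for a descent, read between a virtual initial
  descent and a virtual final ascent; \<open>step_weight y v b c\<close> is the weight of step \<open>c\<close> preceded
  by \<open>b\<close>.  It is the transfer matrix for cutting a permutation into blocks
  \<open>D\<^sub>1 I\<^sub>1 D\<^sub>2 I\<^sub>2 \<dots>\<close>, decreasing and increasing in turn and possibly empty, where each
  entry of a \<open>D\<^sub>i\<close> has weight \<open>y\<close> and each pair \<open>D\<^sub>i I\<^sub>i\<close> has weight \<open>v\<close>, after summing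
  geometric series and clearing their denominators \<open>1 - v\<close>.
\<close>

fun step_weight :: "'a::comm_ring_1 \<Rightarrow> 'a \<Rightarrow> bool \<Rightarrow> bool \<Rightarrow> 'a" where
  "step_weight y v True True = y + v"
| "step_weight y v True False = 1 + y"
| "step_weight y v False True = v * (1 + y)"
| "step_weight y v False False = 1 + y * v"

text \<open>The empty word still takes one step, the virtual final ascent; a permutation of
  \<open>n \<ge> 1\<close> entries therefore gets \<open>n\<close> factors \<open>p\<close>.\<close>

primrec word_weight :: "'a::comm_ring_1 \<Rightarrow> (bool \<Rightarrow> bool \<Rightarrow> 'a) \<Rightarrow> bool \<Rightarrow> bool list \<Rightarrow> 'a" where
  "word_weight p W b [] = p * W b False"
| "word_weight p W b (c # w) = p * W b c * word_weight p W c w"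

text \<open>The exponent counts entries, one more than letters, so \<open>c\<close> is the weight of
  one entry.\<close>

definition ascending :: "'a::comm_ring_1 \<Rightarrow> bool list \<Rightarrow> 'a" where
  "ascending c w = of_bool (True \<notin> set w) * c ^ (length w + 1)"

definition descending :: "'a::comm_ring_1 \<Rightarrow> bool list \<Rightarrow> 'a" where
  "descending c w = of_bool (False \<notin> set w) * c ^ (length w + 1)"

lemma ascending_simps [simp]:
  "ascending c [] = c"
  "ascending c (False # w) = c * ascending c w"
  "ascending c (True # w) = 0"
  by (simp_all add: ascending_def)

lemma descending_simps [simp]:
  "descending c [] = c"
  "descending c (True # w) = c * descending c w"
  "descending c (False # w) = 0"
  by (simp_all add: descending_def)

context
  fixes p y v :: "'a::comm_ring_1"
begin

abbreviation "\<Phi> \<equiv> word_weight p (step_weight y v)"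

text \<open>For \<open>W = step_weight y v\<close>, the difference
  \<open>W False b - v * W True b\<close> is \<open>1 - v\<close> for an ascent \<open>b\<close> and
  \<open>v * (1 - v)\<close> for a descent. An ascent thus extends the increasing block by one entry
  of weight \<open>p * (1 - v)\<close>; a descent ends the block after such an entry and opens a new
  pair of blocks at the price \<open>v\<close>.\<close>

lemma word_weight_False:
  "\<Phi> False w = ascending (p * (1 - v)) w + v * \<Phi> True w + conv (ascending (p * (1 - v))) (\<lambda>w. v * \<Phi> True w) w"
proof (induction w)
  case Nil
  show ?case by (simp add: ascending_def algebra_simps)
next
  case (Cons b w)
  let ?c = "p * (1 - v)"
  show ?case
  proof (cases b)
    case True
    then show ?thesis by (simp add: algebra_simps)
  next
    case False
    have "ascending ?c (False # w) + v * \<Phi> True (False # w) +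
        conv (ascending ?c) (\<lambda>w. v * \<Phi> True w) (False # w) =
       v * \<Phi> True (False # w) + ?c * (ascending ?c w + v * \<Phi> True w + conv (ascending ?c) (\<lambda>w. v * \<Phi> True w) w)"
      by (simp add: conv_scale) (simp add: algebra_simps)
    also have "\<dots> = v * \<Phi> True (False # w) + ?c * \<Phi> False w" by (simp only: Cons.IH[symmetric])
    also have "\<dots> = \<Phi> False (False # w)" by (simp add: algebra_simps)
    finally show ?thesis using False by simp
  qed
qed

text \<open>Here \<open>W True b - W False b\<close> is \<open>y * (1 - v)\<close> for both letters
  \<open>b\<close>. A descent extends the decreasing block and an ascent ends it, each time with one
  entry of weight \<open>p * (1 - v) * y\<close>.\<close>

lemma word_weight_True:
  "\<Phi> True w = descending (p * (1 - v) * y) w + \<Phi> False w + conv (descending (p * (1 - v) * y)) (\<Phi> False) w"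
proof (induction w)
  case Nil
  show ?case by (simp add: descending_def algebra_simps)
next
  case (Cons b w)
  let ?c = "p * (1 - v) * y"
  show ?case
  proof (cases b)
    case False
    then show ?thesis by (simp add: algebra_simps)
  next
    case True
    have "descending ?c (True # w) + \<Phi> False (True # w) +
        conv (descending ?c) (\<Phi> False) (True # w) =
       \<Phi> False (True # w) + ?c * (descending ?c w + \<Phi> False w + conv (descending ?c) (\<Phi> False) w)"
      by (simp add: conv_scale) (simp add: algebra_simps)
    also have "\<dots> = \<Phi> False (True # w) + ?c * \<Phi> True w" by (simp only: Cons.IH[symmetric])
    also have "\<dots> = \<Phi> True (True # w)" by (simp add: algebra_simps)
    finally show ?thesis using True by simp
  qed
qed

end


section \<open>Generating functions of weights on words\<close>

definition inv_gf :: "'a::comm_ring_1 \<Rightarrow> (nat \<Rightarrow> 'a) \<Rightarrow> (bool list \<Rightarrow> 'a) \<Rightarrow> 'a fps" where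
  "inv_gf q \<iota> f = Abs_fps (\<lambda>n. if n = 0 then 0 else \<iota> n * inv_sum q n f)"

lemma inv_sum_linear:
  "inv_sum q n (\<lambda>w. f w + g w) = inv_sum q n f + inv_sum q n g"
  "inv_sum q n (\<lambda>w. a * f w) = a * inv_sum q n f"
  "inv_sum q n (\<lambda>w. \<Sum>k\<in>K. F k w) = (\<Sum>k\<in>K. inv_sum q n (F k))"
  by (simp_all add: inv_sum_def sum.distrib sum_distrib_left algebra_simps sum.swap[of _ K])

lemma inv_gf_add: "inv_gf q \<iota> (\<lambda>w. f w + g w) = inv_gf q \<iota> f + inv_gf q \<iota> g"
  by (rule fps_ext) (simp add: inv_gf_def inv_sum_linear algebra_simps)

lemma inv_gf_scale: "inv_gf q \<iota> (\<lambda>w. a * f w) = fps_const a * inv_gf q \<iota> f"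
  by (rule fps_ext) (simp add: inv_gf_def inv_sum_linear algebra_simps)

lemma inv_sum_cong: "(\<And>w. length w = n - 1 \<Longrightarrow> f w = g w) \<Longrightarrow> inv_sum q n f = inv_sum q n g"
  unfolding inv_sum_def
  by (intro sum.cong refl arg_cong2[where f = "(*)"])
     (auto simp: permutations_of_set_def distinct_card[symmetric])

context
  fixes q :: "'a::comm_ring_1" and \<iota> :: "nat \<Rightarrow> 'a"
  assumes \<iota>: "\<And>n. qfact q n * \<iota> n = 1"
begin

text \<open>\<open>\<iota> n\<close> is the inverse of the q-factorial, given only by its defining
  equation so that the coefficients need not form a field.\<close>

lemma inv_sum_mult_normalized:
  assumes "0 < m" "0 < n"
  shows "(\<iota> m * inv_sum q m f) * (\<iota> n * inv_sum q n g) =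
         \<iota> (m + n) * inv_sum q (m + n) (\<lambda>w. f (take (m - 1) w) * g (drop m w))"
    (is "?L = \<iota> (m + n) * ?I")
proof -
  have "?L = (qfact q (m + n) * \<iota> (m + n)) * ?L" by (simp add: \<iota>)
  also have "\<dots> = \<iota> (m + n) * \<iota> m * \<iota> n * (qfact q (m + n) * (inv_sum q m f * inv_sum q n g))"
    by (simp only: mult_ac)
  also have "\<dots> = \<iota> (m + n) * \<iota> m * \<iota> n * (qfact q m * qfact q n * ?I)"
    by (simp only: inv_sum_mult[OF assms])
  also have "\<dots> = (qfact q m * \<iota> m) * (qfact q n * \<iota> n) * (\<iota> (m + n) * ?I)"
    by (simp only: mult_ac)
  finally show ?thesis by (simp add: \<iota>)
qed

text \<open>The constant terms are 0 because the empty word already belongs to the one-entry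
  permutation. A coefficient of the product thus runs over the cuts into two nonempty blocks, which
  is \<open>conv\<close>.\<close>

lemma inv_gf_mult: "inv_gf q \<iota> f * inv_gf q \<iota> g = inv_gf q \<iota> (conv f g)"
proof (rule fps_ext)
  fix n
  show "fps_nth (inv_gf q \<iota> f * inv_gf q \<iota> g) n = fps_nth (inv_gf q \<iota> (conv f g)) n"
  proof (cases n)
    case 0
    then show ?thesis by (simp add: inv_gf_def)
  next
    case (Suc m)
    have "fps_nth (inv_gf q \<iota> f * inv_gf q \<iota> g) n = 
      (\<Sum>k\<in>{0..n}. fps_nth (inv_gf q \<iota> f) k * fps_nth (inv_gf q \<iota> g) (n - k))"
      by (simp add: fps_mult_nth)
    \<comment> \<open>The terms \<open>k = 0\<close> and \<open>k = n\<close> vanish with the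
      constant terms.\<close>
    also have "\<dots> = (\<Sum>k\<in>{1..m}. fps_nth (inv_gf q \<iota> f) k * fps_nth (inv_gf q \<iota> g) (n - k))"
      by (rule sum.mono_neutral_right) (use Suc in \<open>auto simp: inv_gf_def\<close>)
    also have "\<dots> = (\<Sum>k<m. fps_nth (inv_gf q \<iota> f) (Suc k) * fps_nth (inv_gf q \<iota> g) (m - k))"
      by (rule sum.reindex_bij_witness[where i = Suc and j = "\<lambda>k. k - 1"]) (use Suc in auto)
    also have "\<dots> = (\<Sum>k<m. \<iota> n * inv_sum q n (\<lambda>w. f (take k w) * g (drop (Suc k) w)))"
    proof (intro sum.cong refl, goal_cases)
      case (1 k)
      then show ?case
        using Suc inv_sum_mult_normalized[of "Suc k" "m - k" f g] by (simp add: inv_gf_def)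
    qed
    also have "\<dots> = \<iota> n * inv_sum q n (\<lambda>w. \<Sum>k<m. f (take k w) * g (drop (Suc k) w))"
      by (simp only: inv_sum_linear sum_distrib_left)
    also have "inv_sum q n (\<lambda>w. \<Sum>k<m. f (take k w) * g (drop (Suc k) w)) = inv_sum q n (conv f g)"
      by (rule inv_sum_cong) (simp add: Suc conv_def)
    finally show ?thesis using Suc by (simp add: inv_gf_def)
  qed
qed

lemma inv_gf_ascending: "inv_gf q \<iota> (ascending c) = Abs_fps (\<lambda>n. \<iota> n * c ^ n) - 1"
proof (rule fps_ext)
  fix n
  have \<iota>0: "\<iota> 0 = 1" using \<iota>[of 0] by (simp add: qfact_def)
  have "inv_sum q n (ascending c) = c ^ n * inv_sum q n (\<lambda>w. of_bool (True \<notin> set w))" if "n > 0"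
    unfolding inv_sum_linear(2)[symmetric] using that
    by (intro inv_sum_cong) (simp add: ascending_def power_Suc[symmetric] del: power_Suc)
  then show "fps_nth (inv_gf q \<iota> (ascending c)) n = fps_nth (Abs_fps (\<lambda>n. \<iota> n * c ^ n) - 1) n"
    by (cases "n = 0") (simp_all add: inv_gf_def inv_sum_ascending \<iota>0)
qed

lemma inv_gf_descending: "inv_gf q \<iota> (descending c) = Abs_fps (\<lambda>n. q ^ (n choose 2) * \<iota> n * c ^ n) - 1"
proof (rule fps_ext)
  fix n
  have \<iota>0: "\<iota> 0 = 1" using \<iota>[of 0] by (simp add: qfact_def)
  have "inv_sum q n (descending c) = c ^ n * inv_sum q n (\<lambda>w. of_bool (False \<notin> set w))" if "n > 0"
    unfolding inv_sum_linear(2)[symmetric] using that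
    by (intro inv_sum_cong) (simp add: descending_def power_Suc[symmetric] del: power_Suc)
  then show "fps_nth (inv_gf q \<iota> (descending c)) n = fps_nth (Abs_fps (\<lambda>n. q ^ (n choose 2) * \<iota> n * c ^ n) - 1) n"
    by (cases "n = 0") (simp_all add: inv_gf_def inv_sum_descending \<iota>0 mult_ac numeral_2_eq_2)
qed

text \<open>The two recurrences for \<open>word_weight\<close> become
  \<open>1 + ?B = ?A * (1 + fps_const v * T)\<close> and \<open>1 + T = ?D * (1 + ?B)\<close>;
  eliminating \<open>?B\<close> leaves a linear equation for \<open>T\<close>. The free scale
  \<open>p\<close> gives \<open>c\<close> the value needed in each identity.\<close>

lemma inv_gf_functional_equation:
  fixes p y v :: 'a
  defines "c \<equiv> p * (1 - v)"
  defines "F \<equiv> Abs_fps (\<lambda>n. q ^ (n choose 2) * \<iota> n * (c * y) ^ n) * Abs_fps (\<lambda>n. \<iota> n * c ^ n)"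
  defines "T \<equiv> inv_gf q \<iota> (word_weight p (step_weight y v) True)"
  shows "T * (1 - fps_const v * F) = F - 1"
proof -
  let ?A = "Abs_fps (\<lambda>n. \<iota> n * c ^ n)"
  let ?D = "Abs_fps (\<lambda>n. q ^ (n choose 2) * \<iota> n * (c * y) ^ n)"
  let ?B = "inv_gf q \<iota> (word_weight p (step_weight y v) False)"
  have "?B = (?A - 1) + fps_const v * T + (?A - 1) * (fps_const v * T)"
    unfolding T_def inv_gf_scale[symmetric] inv_gf_ascending[symmetric] inv_gf_mult inv_gf_add[symmetric]
    by (simp only: c_def word_weight_False[symmetric])
  then have B: "1 + ?B = ?A * (1 + fps_const v * T)" by (simp add: algebra_simps)
  have "T = (?D - 1) + ?B + (?D - 1) * ?B"
    unfolding T_def inv_gf_descending[symmetric] inv_gf_mult inv_gf_add[symmetric]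
    by (simp only: c_def word_weight_True[symmetric])
  then have "1 + T = ?D * (1 + ?B)" by (simp add: algebra_simps)
  then have "1 + T = F * (1 + fps_const v * T)" unfolding B F_def by (simp only: mult.assoc)
  then show ?thesis by (simp add: algebra_simps)
qed

end

section \<open>Peaks\<close>

text \<open>A peak is an ascent followed by a descent, and \<open>b\<close> is the letter in front
  of the word. Starting from \<open>True\<close> keeps the first entry of a permutation from
  counting as a peak.\<close>

primrec peaks :: "bool \<Rightarrow> bool list \<Rightarrow> nat" where
  "peaks b [] = 0"
| "peaks b (c # w) = of_bool (\<not> b \<and> c) + peaks c w"

lemma peaks_snoc: "peaks b (w @ [c]) = peaks b w + of_bool (\<not> last (b # w) \<and> c)"
  by (induction w arbitrary: b) auto

lemma peaks_map_upt: "peaks (h 0) (map h [1..<Suc m]) = card {i \<in> {1..m}. \<not> h (i - 1) \<and> h i}"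
proof (induction m)
  case (Suc m)
  have l: "last (h 0 # map h [1..<Suc m]) = h m"
    by (cases m) auto
  have *: "{i \<in> {1..Suc m}. \<not> h (i - 1) \<and> h i} = {i \<in> {1..m}. \<not> h (i - 1) \<and> h i} \<union> (if \<not> h m \<and> h (Suc m) then {Suc m} else {})"
    by (auto simp: le_Suc_eq)
  have "peaks (h 0) (map h [1..<Suc (Suc m)]) = peaks (h 0) (map h [1..<Suc m]) + of_bool (\<not> h m \<and> h (Suc m))"
    using peaks_snoc[of "h 0" "map h [1..<Suc m]" "h (Suc m)"] unfolding l by simp
  then show ?case unfolding Suc.IH * by (subst card_Un_disjoint) auto
qed simp

section \<open>Statistics of permutations read off their descent words\<close>

lemma nth_descents: "Suc i < length xs \<Longrightarrow> descents xs ! i \<longleftrightarrow> xs ! i > xs ! Suc i"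
  by (induction xs arbitrary: i rule: descents.induct) (auto simp: nth_Cons split: nat.splits)

lemma descents_map_upt: "descents (map \<pi> [1..<Suc n]) = map (\<lambda>i. \<pi> i > \<pi> (Suc i)) [1..<n]"
  by (rule nth_equalityI) (auto simp: nth_descents simp del: upt_Suc)

lemma count_descents: "count_list (descents (map \<pi> [1..<Suc n])) True = des n \<pi>"
  unfolding descents_map_upt des_def count_list_eq_length_filter filter_map length_map
  by (subst distinct_length_filter) (auto intro!: arg_cong[where f = card])

lemma peaks_descents:
  assumes "inj \<pi>"
  shows "peaks True (descents (map \<pi> [1..<Suc n])) = pk n \<pi>"
proof (cases n)
  case (Suc m)
  \<comment> \<open>Position 0 carries the virtual initial descent, so \<open>i = 1\<close> cannot
    satisfy \<open>\<not> h (i - 1)\<close> and the indices start at 2, as in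
    \<open>pk\<close>.\<close>
  define h where "h = (\<lambda>i. i = 0 \<or> \<pi> i > \<pi> (Suc i))"
  have *: "map (\<lambda>i. \<pi> i > \<pi> (Suc i)) [1..<n] = map h [1..<n]"
    by (auto simp: h_def)
  have "h 0" by (simp add: h_def)
  then have "peaks True (descents (map \<pi> [1..<Suc n])) = peaks (h 0) (map h [1..<Suc m])"
    unfolding descents_map_upt * using Suc by (simp del: upt_Suc)
  also have "\<dots> = card {i \<in> {1..m}. \<not> h (i - 1) \<and> h i}"
    by (rule peaks_map_upt)
  also have "{i \<in> {1..m}. \<not> h (i - 1) \<and> h i} = {i \<in> {2..n - 1}. \<pi> (i - 1) < \<pi> i \<and> \<pi> i > \<pi> (i + 1)}"
  proof -
    \<comment> \<open>Injectivity turns the absence of a descent into a strict ascent.\<close>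
    have "\<pi> (i - 1) < \<pi> i \<longleftrightarrow> \<not> \<pi> i < \<pi> (i - 1)" if "i \<ge> 2" for i
      using injD[OF assms, of "i - 1" i] that by fastforce
    then show ?thesis using Suc by (auto simp: h_def)
  qed
  finally show ?thesis by (simp add: pk_def)
qed (simp add: pk_def)

lemma inversions_map_upt:
  assumes "inj \<pi>"
  shows "inversions (map \<pi> [a..<b]) = (\<Sum>i\<in>{a..<b}. card {j \<in> {i<..<b}. \<pi> j < \<pi> i})"
proof (induction "b - a" arbitrary: a)
  case (Suc m)
  then have ab: "a < b" by simp
  have "{y \<in> \<pi> ` {Suc a..<b}. y < \<pi> a} = \<pi> ` {j \<in> {a<..<b}. \<pi> j < \<pi> a}" by auto
  then have "card {y \<in> \<pi> ` {Suc a..<b}. y < \<pi> a} = card {j \<in> {a<..<b}. \<pi> j < \<pi> a}"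
    using assms by (simp add: card_image inj_on_subset)
  moreover have "inversions (map \<pi> [Suc a..<b]) = (\<Sum>i\<in>{Suc a..<b}. card {j \<in> {i<..<b}. \<pi> j < \<pi> i})"
    using Suc by auto
  ultimately show ?case
    using ab by (simp add: upt_conv_Cons sum.atLeast_Suc_lessThan)
qed simp

lemma inversions_eq_inv_stat:
  assumes "inj \<pi>"
  shows "inversions (map \<pi> [1..<Suc n]) = inv_stat n \<pi>"
proof -
  have "{(i, j). 1 \<le> i \<and> i < j \<and> j \<le> n \<and> \<pi> i > \<pi> j} =
      (SIGMA i:{1..<Suc n}. {j \<in> {i<..<Suc n}. \<pi> j < \<pi> i})"
    by auto
  then show ?thesis unfolding inv_stat_def inversions_map_upt[OF assms] by simp
qed

lemma bij_betw_permutes_permutations_of_set: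
  "bij_betw (\<lambda>\<pi>. map \<pi> [1..<Suc n]) {\<pi>. \<pi> permutes {1..n}} (permutations_of_set {1..n})"
proof -
  have "inj_on (\<lambda>\<pi>. map \<pi> [1..<Suc n]) {\<pi>. \<pi> permutes {1..n}}"
  proof (rule inj_onI, rule ext, goal_cases)
    case (1 \<pi> \<sigma> i)
    then show ?case
      by (cases "i \<in> {1..n}") (auto simp: permutes_not_in simp del: upt_Suc)
  qed
  moreover have "(\<lambda>\<pi>. map \<pi> [1..<Suc n]) ` {\<pi>. \<pi> permutes {1..n}} \<subseteq> permutations_of_set {1..n}"
  proof (clarify, rule permutations_of_setI)
    fix \<pi> assume \<pi>: "\<pi> permutes {1..n}"
    have "set (map \<pi> [1..<Suc n]) = \<pi> ` {1..n}" by (auto simp del: upt_Suc)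
    then show "set (map \<pi> [1..<Suc n]) = {1..n}" using permutes_image[OF \<pi>] by simp
    show "distinct (map \<pi> [1..<Suc n])"
      using inj_on_subset[OF permutes_inj[OF \<pi>] subset_UNIV] by (simp add: distinct_map del: upt_Suc)
  qed
  \<comment> \<open>Both sets have \<open>fact n\<close> elements, so injectivity yields
    surjectivity.\<close>
  moreover have "card {\<pi>. \<pi> permutes {1..n}} = card (permutations_of_set {1..n})"
    by (subst card_permutations[of _ n]) simp_all
  ultimately show ?thesis
    by (simp add: bij_betw_def card_image card_subset_eq)
qed

text \<open>The factor \<open>y * t\<close> comes from the exponents \<open>pk n \<pi> + 1\<close>
  and \<open>des n \<pi> + 1\<close>.\<close>

lemma P_inv_pk_des_eq_inv_sum:
  "P_inv_pk_des n q y t = y * t * inv_sum q n (\<lambda>w. y ^ peaks True w * t ^ count_list w True)"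
proof -
  let ?f = "\<lambda>w. y ^ peaks True w * t ^ count_list w True"
  have "inv_sum q n ?f = (\<Sum>xs\<in>permutations_of_set {1..n}. q ^ inversions xs * ?f (descents xs))"
    using sum_permutations_relabel[of "{1..n}" q ?f] by simp
  also have "\<dots> = (\<Sum>\<pi> | \<pi> permutes {1..n}. q ^ inv_stat n \<pi> * (y ^ pk n \<pi> * t ^ des n \<pi>))"
    unfolding sum.reindex_bij_betw[OF bij_betw_permutes_permutations_of_set, symmetric]
    by (intro sum.cong refl)
      (simp only: mem_Collect_eq inversions_eq_inv_stat peaks_descents count_descents permutes_inj)
  finally show ?thesis
    by (simp add: P_inv_pk_des_def sum_distrib_left mult_ac)
qed

text \<open>Between the virtual steps, a word \<open>w\<close> with \<open>k\<close> peaks and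
  \<open>d\<close> descents has \<open>k\<close> pairs ascent-descent, \<open>k + 1\<close> pairs
  descent-ascent, \<open>d - k\<close> double descents and \<open>length w - k - d\<close> double
  ascents. One descent-ascent pair stays unmatched and gives the leading factor. The second claim
  keeps that factor on both sides so that \<open>ad\<close> applies without cancellation.\<close>

lemma word_weight_eq_peaks_descents:
  fixes p \<kappa> y t :: "'a::comm_ring_1"
  assumes dd: "p * W True True = \<kappa> * t" and aa: "p * W False False = \<kappa>"
    and ad: "(p * W True False) * (p * W False True) = \<kappa> ^ 2 * (y * t)"
  shows "word_weight p W True w =
           p * W True False * (\<kappa> ^ length w * (y ^ peaks True w * t ^ count_list w True))"
    and "p * W True False * word_weight p W False w =
           p * W True False * (\<kappa> ^ (length w + 1) * (y ^ peaks False w * t ^ count_list w True))"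
proof (induction w)
  case (Cons c w)
  {
    case 1
    show ?case
    proof (cases c)
      case True
      then have "word_weight p W True (c # w) = (p * W True True) * word_weight p W True w" by simp
      then show ?thesis unfolding dd Cons.IH(1) using True by (simp add: mult_ac)
    next
      case False
      then show ?thesis using Cons.IH(2) by (simp add: mult_ac)
    qed
  next
    case 2
    show ?case
    proof (cases c)
      case True
      then have "p * W True False * word_weight p W False (c # w) =
          ((p * W True False) * (p * W False True)) * word_weight p W True w"
        by (simp add: mult_ac)
      then show ?thesis unfolding ad Cons.IH(1) using True by (simp add: mult_ac power2_eq_square)
    next
      case False
      then have "p * W True False * word_weight p W False (c # w) =
          (p * W False False) * (p * W True False * word_weight p W False w)"
        by (simp add: mult_ac)
      then show ?thesis unfolding aa Cons.IH(2) using False by (simp add: mult_ac)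
    qed
  }
qed (use aa in simp_all)

text \<open>The three equations for \<open>\<kappa>\<close>, \<open>y'\<close> and \<open>t'\<close>
  instantiate the pair weights of \<open>word_weight_eq_peaks_descents\<close>. The series is
  multiplied by \<open>y' * t'\<close>, a factor of every \<open>P_inv_pk_des\<close>, instead of
  dividing by it.\<close>

lemma inv_gf_word_weight:
  fixes q p \<kappa> y v y' t' :: "'a::comm_ring_1"
  assumes \<iota>: "\<And>n. qfact q n * \<iota> n = 1"
    and dd: "p * (y + v) = \<kappa> * t'" and aa: "p * (1 + y * v) = \<kappa>"
    and ad: "p ^ 2 * (v * (1 + y) ^ 2) = \<kappa> ^ 2 * (y' * t')"
  shows "fps_const (y' * t') * inv_gf q \<iota> (word_weight p (step_weight y v) True) =
    Abs_fps (\<lambda>n. if n = 0 then 0 else p * (1 + y) * \<kappa> ^ (n - 1) * (P_inv_pk_des n q y' t' * \<iota> n))"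
proof (rule fps_ext)
  fix n
  let ?f = "\<lambda>w. y' ^ peaks True w * t' ^ count_list w True"
  have W: "word_weight p (step_weight y v) True w = p * (1 + y) * (\<kappa> ^ length w * ?f w)" for w
    using word_weight_eq_peaks_descents(1)[of p "step_weight y v" \<kappa> t' y' w] dd aa ad
    by (simp add: power2_eq_square mult_ac)
  have "inv_sum q n (word_weight p (step_weight y v) True) = inv_sum q n (\<lambda>w. (p * (1 + y) * \<kappa> ^ (n - 1)) * ?f w)"
    by (rule inv_sum_cong) (simp add: W mult.assoc)
  then have *: "inv_sum q n (word_weight p (step_weight y v) True) = p * (1 + y) * \<kappa> ^ (n - 1) * inv_sum q n ?f"
    by (simp only: inv_sum_linear)
  show "fps_nth (fps_const (y' * t') * inv_gf q \<iota> (word_weight p (step_weight y v) True)) n =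
     fps_nth (Abs_fps (\<lambda>n. if n = 0 then 0 else p * (1 + y) * \<kappa> ^ (n - 1) * (P_inv_pk_des n q y' t' * \<iota> n))) n"
    by (simp add: inv_gf_def * P_inv_pk_des_eq_inv_sum mult_ac)
qed

text \<open>With \<open>p\<close> inverse to \<open>1 + u * v\<close> and \<open>u\<close> as the
  weight of a descending entry, these are the hypotheses of \<open>inv_gf_word_weight\<close> for
  \<open>\<kappa> = 1\<close>. They follow by clearing denominators and eliminating the square
  root.\<close>

lemma u_v_relations:
  defines "u \<equiv> u_ser" and "v \<equiv> v_ser" and "y \<equiv> y_ser" and "t \<equiv> t_ser"
  shows "u + v = (1 + u * v) * t" and "v * (1 + u) ^ 2 = (1 + u * v) ^ 2 * (y * t)"
proof -
  define r where "r = root_ser"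
  have nz: "y \<noteq> 0" "t \<noteq> 0" "1 - y \<noteq> 0"
    by (simp_all add: y_def t_def y_ser_def t_ser_def one_pCons fps_const_1_eq_1[symmetric] del: fps_const_1_eq_1)
  have r: "r ^ 2 = (1 + t) ^ 2 - 4 * y * t"
    unfolding r_def y_def t_def by (rule root_ser)
  have u: "u * (2 * (1 - y) * t) = 1 + t ^ 2 - 2 * y * t - (1 - t) * r"
    unfolding u_def y_def t_def r_def by (rule u_ser)
  have v: "v * (2 * y * t) = (1 + t) ^ 2 - 2 * y * t - (1 + t) * r"
    unfolding v_def y_def t_def r_def by (rule v_ser)
  \<comment> \<open>The multiplier is the product of the denominators of \<open>u\<close> and
    \<open>v\<close>.\<close>
  have "(u + v) * (4 * y * (1 - y) * t ^ 2) = ((1 + u * v) * t) * (4 * y * (1 - y) * t ^ 2)"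
    using r u v by algebra
  then show 1: "u + v = (1 + u * v) * t" using nz by simp
  \<comment> \<open>The multiplier is the denominator of \<open>v\<close> times the square of that
    of \<open>u\<close>.\<close>
  have "(v * (1 + u) ^ 2) * (2 * y * (2 * (1 - y)) ^ 2 * t ^ 3) = 
     ((1 + u * v) ^ 2 * (y * t)) * (2 * y * (2 * (1 - y)) ^ 2 * t ^ 3)"
    using r u v 1 by algebra
  then show "v * (1 + u) ^ 2 = (1 + u * v) ^ 2 * (y * t)" using nz by simp
qed

section \<open>The two identities\<close>

text \<open>A vanishing factor \<open>1 + r + ... + r ^ (k - 1)\<close> would exhibit
  \<open>r\<close> as a unit.\<close>

lemma qfact_to_fract_nonzero:
  fixes r :: "'a::idom"
  assumes "\<not> r dvd 1"
  shows "qfact (to_fract r) n \<noteq> 0"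
proof -
  have to_fract_power: "to_fract r ^ i = to_fract (r ^ i)" for i
    by (induction i) simp_all
  have "(\<Sum>i<k. r ^ i) \<noteq> 0" if k: "k \<ge> 1" for k
  proof
    assume *: "(\<Sum>i<k. r ^ i) = 0"
    obtain m where "k = Suc m" using k by (cases k) auto
    then have "1 = r * - (\<Sum>i<m. r ^ i)"
      using * by (simp add: sum.lessThan_Suc_shift sum_distrib_left add_eq_0_iff2 del: sum.lessThan_Suc)
    then show False using assms by (metis dvd_triv_left)
  qed
  then show ?thesis
    by (simp add: qfact_def to_fract_power flip: to_fract_sum)
qed

lemma qfact_q_rat_nonzero: "qfact q_rat n \<noteq> 0"
  unfolding q_rat_def by (rule qfact_to_fract_nonzero) (simp add: is_unit_poly_iff)

lemma qfact_q_rat_q_nonzero: "qfact q_rat_q n \<noteq> 0"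
  unfolding q_rat_q_def by (rule qfact_to_fract_nonzero) (simp add: is_unit_poly_iff)

lemma rat_denominators_nonzero:
  "1 + y_rat \<noteq> 0" "1 - t_rat \<noteq> 0" "1 + y_rat * t_rat \<noteq> 0" "y_rat + t_rat \<noteq> 0"
  unfolding y_rat_def t_rat_def to_fract_1[symmetric] to_fract_add[symmetric] to_fract_diff[symmetric]
    to_fract_mult[symmetric] to_fract_eq_0_iff
  by (simp_all add: one_pCons)

text \<open>With \<open>F = ?E * ?e\<close>, the left side is
  \<open>1 + t * (F - 1) / (1 - t * F)\<close>, hence \<open>1 + t * T\<close> by the functional
  equation with \<open>v = t\<close>.\<close>

lemma inv_pk_des_gf_rational:
  fixes q y t :: "'a::field"
  assumes q: "\<And>n. qfact q n \<noteq> 0"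
    and nz: "1 + y \<noteq> 0" "1 - t \<noteq> 0" "1 + y * t \<noteq> 0" "y + t \<noteq> 0"
  shows "fps_const (1 - t) /
          (1 - fps_const t * (Exp_q q oo (fps_const y * fps_X)) * exp_q q) =
        1 + Abs_fps (\<lambda>n. if n = 0 then 0 else
              (1 + y * t) ^ (n + 1) / ((1 + y) * (1 - t) ^ n) *
              P_inv_pk_des n q ((1 + y) ^ 2 * t / ((y + t) * (1 + y * t)))
                               ((y + t) / (1 + y * t)) *
              (1 / qfact q n))" (is "_ / (1 - _ * ?E * ?e) = 1 + ?R")
proof -
  define \<iota> where "\<iota> n = 1 / qfact q n" for n
  have \<iota>: "qfact q n * \<iota> n = 1" for n using q by (simp add: \<iota>_def)
  \<comment> \<open>This \<open>p\<close> makes \<open>c = p * (1 - t)\<close> equal to 1; the other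
    three values solve the equations of \<open>inv_gf_word_weight\<close>.\<close>
  define p \<kappa> y' t' where defs: "p = 1 / (1 - t)" "\<kappa> = (1 + y * t) / (1 - t)"
    "y' = (1 + y) ^ 2 * t / ((y + t) * (1 + y * t))" "t' = (y + t) / (1 + y * t)"
  define T where "T = inv_gf q \<iota> (word_weight p (step_weight y t) True)"
  have y't': "y' * t' = (1 + y) ^ 2 * t / (1 + y * t) ^ 2"
    using nz by (simp add: defs power2_eq_square)
  have "fps_const (y' * t') * T =
    Abs_fps (\<lambda>n. if n = 0 then 0 else p * (1 + y) * \<kappa> ^ (n - 1) * (P_inv_pk_des n q y' t' * \<iota> n))"
    unfolding T_def
  proof (rule inv_gf_word_weight[OF \<iota>])
    show "p * (y + t) = \<kappa> * t'" "p * (1 + y * t) = \<kappa>" using nz by (simp_all add: defs)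
    show "p\<^sup>2 * (t * (1 + y)\<^sup>2) = \<kappa>\<^sup>2 * (y' * t')"
      unfolding y't' using nz by (simp add: defs power_divide)
  qed
  note this[THEN arg_cong, of "\<lambda>g. fps_nth g n" for n]
  then have T: "(y' * t') * fps_nth T n = p * (1 + y) * \<kappa> ^ (n - 1) * (P_inv_pk_des n q y' t' * \<iota> n)"
    if "n \<noteq> 0" for n
    using that by simp
  have R: "fps_const t * T = ?R"
  proof (rule fps_ext)
    fix n
    show "fps_nth (fps_const t * T) n = fps_nth ?R n"
    proof (cases n)
      case 0
      then show ?thesis by (simp add: T_def inv_gf_def)
    next
      case (Suc m)
      \<comment> \<open>Only the product with \<open>y' * t'\<close> is known, so \<open>t\<close>
        is rewritten as a multiple of it.\<close>
      have "t * fps_nth T n = (1 + y * t) ^ 2 / (1 + y) ^ 2 * ((y' * t') * fps_nth T n)"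
        unfolding y't' using nz by simp
      also have "\<dots> = (1 + y * t) ^ 2 / (1 + y) ^ 2 * (p * (1 + y) * \<kappa> ^ m) * (P_inv_pk_des n q y' t' * \<iota> n)"
        using T[of n] Suc by (simp add: mult.assoc)
      also have "(1 + y * t) ^ 2 / (1 + y) ^ 2 * (p * (1 + y) * \<kappa> ^ m) =
          (1 + y * t) ^ (n + 1) / ((1 + y) * (1 - t) ^ n)"
        unfolding Suc using nz by (simp add: defs power_divide power2_eq_square)
      finally show ?thesis using Suc by (simp add: defs \<iota>_def)
    qed
  qed
  let ?D = "1 - fps_const t * (?E * ?e)"
  have E: "?E = Abs_fps (\<lambda>n. q ^ (n choose 2) * \<iota> n * (p * (1 - t) * y) ^ n)"
    unfolding fps_compose_linear using nz by (simp add: Exp_q_def \<iota>_def defs(1) mult_ac)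
  have e: "?e = Abs_fps (\<lambda>n. \<iota> n * (p * (1 - t)) ^ n)"
    using nz by (simp add: exp_q_def \<iota>_def defs(1))
  have FE: "T * ?D = ?E * ?e - 1"
    unfolding E e T_def by (rule inv_gf_functional_equation[OF \<iota>])
  have "fps_nth ?D 0 = 1 - t"
    by (simp add: Exp_q_def exp_q_def qfact_def numeral_2_eq_2)
  then have D: "?D \<noteq> 0" using nz(2) by (metis fps_zero_nth)
  have "(1 + ?R) * ?D = ?D + fps_const t * (T * ?D)"
    unfolding R[symmetric] by (simp only: distrib_right mult_1 mult.assoc)
  also have "\<dots> = 1 - fps_const t"
    unfolding FE by (simp only: right_diff_distrib mult.right_neutral diff_add_cancel add_diff_eq)
  also have "\<dots> = fps_const (1 - t)" by simp
  finally have eq: "fps_const (1 - t) = (1 + ?R) * ?D" by (rule sym)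
  have assoc: "fps_const t * ?E * ?e = fps_const t * (?E * ?e)" by (rule mult.assoc)
  show ?thesis
    unfolding assoc eq using D by (rule nonzero_mult_div_cancel_right)
qed

lemma of_rat_q_hom:
  "of_rat_q 0 = 0" "of_rat_q 1 = 1" "of_rat_q (a + b) = of_rat_q a + of_rat_q b"
  "of_rat_q (a * b) = of_rat_q a * of_rat_q b"
  by (simp_all add: of_rat_q_def one_pCons flip: fps_const_1_eq_1 fps_const_add fps_const_mult)

lemma of_rat_q_power: "of_rat_q (a ^ n) = of_rat_q a ^ n"
  by (induction n) (simp_all add: of_rat_q_hom)

lemma of_rat_q_sum: "of_rat_q (sum f A) = (\<Sum>x\<in>A. of_rat_q (f x))"
  by (induction A rule: infinite_finite_induct) (simp_all add: of_rat_q_hom)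

lemma of_rat_q_prod: "of_rat_q (prod f A) = (\<Prod>x\<in>A. of_rat_q (f x))"
  by (induction A rule: infinite_finite_induct) (simp_all add: of_rat_q_hom)

lemma of_rat_q_qfact: "of_rat_q (qfact q n) = qfact (of_rat_q q) n"
  by (simp add: qfact_def of_rat_q_prod of_rat_q_sum of_rat_q_power)

text \<open>With \<open>p\<close> inverse to \<open>1 + u * v\<close>, the relations between
  \<open>u\<close> and \<open>v\<close> give \<open>\<kappa> = 1\<close>, \<open>y' = y\<close> and
  \<open>t' = t\<close>, so the coefficients are \<open>P_inv_pk_des\<close> at \<open>y\<close> and
  \<open>t\<close> themselves.\<close>

lemma inv_pk_des_gf_series:
  defines "F \<equiv> (fps_map of_rat_q (Exp_q q_rat_q) oo
                 (fps_const ((u_ser * (1 - v_ser)) \<div> (1 + u_ser * v_ser)) * fps_X)) *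
              (fps_map of_rat_q (exp_q q_rat_q) oo
                 (fps_const ((1 - v_ser) \<div> (1 + u_ser * v_ser)) * fps_X))"
  shows "Abs_fps (\<lambda>n. if n = 0 then 0 else
              P_inv_pk_des n (of_rat_q q_rat_q) y_ser t_ser * of_rat_q (1 / qfact q_rat_q n)) =
        fps_const ((v_ser * (1 + u_ser)) \<div> (1 + u_ser * v_ser)) * ((F - 1) \<div> (1 - fps_const v_ser * F))"
    (is "?L = _")
proof -
  define u v y t q where defs: "u = u_ser" "v = v_ser" "y = y_ser" "t = t_ser" "q = of_rat_q q_rat_q"
  define \<iota> where "\<iota> n = of_rat_q (1 / qfact q_rat_q n)" for n
  have \<iota>: "qfact q n * \<iota> n = 1" for n
    using qfact_q_rat_q_nonzero[of n]
    by (simp add: \<iota>_def defs of_rat_q_qfact[symmetric] of_rat_q_hom(4)[symmetric] of_rat_q_hom(2))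
  define p where "p = 1 \<div> (1 + u * v)"
  have p: "p * (1 + u * v) = 1" unfolding p_def defs by (rule exact_div_one_plus_uv)
  have div: "a \<div> (1 + u * v) = a * p" for a
  proof (rule exact_div_eqI)
    show "1 + u * v \<noteq> 0" using p by auto
    show "a * p * (1 + u * v) = a" using p by (simp add: mult.assoc)
  qed
  define T where "T = inv_gf q \<iota> (word_weight p (step_weight u v) True)"
  have uv: "u + v = (1 + u * v) * t" "v * (1 + u) ^ 2 = (1 + u * v) ^ 2 * (y * t)"
    using u_v_relations by (simp_all add: defs)
  have sq: "p\<^sup>2 * (v * (1 + u)\<^sup>2) = y * t"
    unfolding uv(2) using p by (simp add: power_mult_distrib[symmetric] mult.assoc[symmetric])
  have "fps_const (y * t) * T =
    Abs_fps (\<lambda>n. if n = 0 then 0 else p * (1 + u) * 1 ^ (n - 1) * (P_inv_pk_des n q y t * \<iota> n))"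
    unfolding T_def
  proof (rule inv_gf_word_weight[OF \<iota>])
    show "p * (u + v) = 1 * t" unfolding uv(1) using p by (simp add: mult.assoc[symmetric])
  qed (use p sq in \<open>simp_all\<close>)
  also have "\<dots> = fps_const (p * (1 + u)) * ?L"
    by (rule fps_ext) (simp add: \<iota>_def defs)
  \<comment> \<open>By \<open>sq\<close>, \<open>y * t\<close> is \<open>p * (1 + u)\<close> times
    \<open>p * v * (1 + u)\<close>; the first factor is nonzero and gets cancelled.\<close>
  finally have eq: "fps_const (p * (1 + u)) * ?L = fps_const (p * (1 + u)) * (fps_const (p * v * (1 + u)) * T)"
    unfolding sq[symmetric] by (auto simp: power2_eq_square mult_ac simp flip: fps_const_mult)
  have nz: "p * (1 + u) \<noteq> 0"
  proof
    assume "p * (1 + u) = 0"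
    then have "y * t = 0" unfolding sq[symmetric] by (auto simp: power2_eq_square)
    then show False by (simp add: defs y_ser_def t_ser_def)
  qed
  have L: "?L = fps_const (p * v * (1 + u)) * T"
    by (rule iffD1[OF mult_left_cancel[OF fps_const_nonzero_eq_nonzero[OF nz]] eq])
  have "F = Abs_fps (\<lambda>n. q ^ (n choose 2) * \<iota> n * (p * (1 - v) * u) ^ n) * Abs_fps (\<lambda>n. \<iota> n * (p * (1 - v)) ^ n)"
  proof -
    have "of_rat_q (q_rat_q ^ (n choose 2) / qfact q_rat_q n) = q ^ (n choose 2) * \<iota> n" for n
      using of_rat_q_hom(4)[of "q_rat_q ^ (n choose 2)" "1 / qfact q_rat_q n"]
      by (simp add: \<iota>_def defs of_rat_q_power)
    then show ?thesis
      unfolding F_def defs(1,2)[symmetric] div fps_compose_linear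
      by (simp add: fps_map_def Exp_q_def exp_q_def \<iota>_def[symmetric] mult_ac)
  qed
  then have T: "T * (1 - fps_const v * F) = F - 1"
    unfolding T_def using inv_gf_functional_equation[OF \<iota>, of p u v] by simp
  have "qfact q_rat_q 0 = 1" by (simp add: qfact_def)
  then have F0: "fps_nth F 0 = 1"
    by (simp add: F_def fps_compose_linear fps_map_def Exp_q_def exp_q_def of_rat_q_hom numeral_2_eq_2)
  \<comment> \<open>The constant coefficient in \<open>x\<close> is \<open>1 - v\<close>, and
    \<open>v\<close> has constant coefficient 0 in \<open>t\<close>.\<close>
  have "1 - fps_const v * F \<noteq> 0"
  proof
    assume "1 - fps_const v * F = 0"
    then have "fps_nth (fps_nth (1 - fps_const v * F) 0) 0 = 0" by simp
    then show False by (simp add: F0 defs fps_nth_v_ser_0)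
  qed
  then have "(F - 1) \<div> (1 - fps_const v * F) = T"
    using T by (rule exact_div_eqI)
  then show ?thesis
    unfolding L defs(1,2)[symmetric] div by (simp add: mult_ac)
qed

theorem theorem4p3:
  shows
    "(let q = q_rat; y = y_rat; t = t_rat in
        fps_const (1 - t) /
          (1 - fps_const t * (Exp_q q oo (fps_const y * fps_X)) * exp_q q) =
        1 + Abs_fps (\<lambda>n. if n = 0 then 0 else
              (1 + y * t) ^ (n + 1) / ((1 + y) * (1 - t) ^ n) *
              P_inv_pk_des n q ((1 + y) ^ 2 * t / ((y + t) * (1 + y * t)))
                               ((y + t) / (1 + y * t)) *
              (1 / qfact q n)))
     \<and>
     (let q = q_rat_q; y = y_ser; t = t_ser; u = u_ser; v = v_ser;
          F = (fps_map of_rat_q (Exp_q q) oo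
                 (fps_const ((u * (1 - v)) \<div> (1 + u * v)) * fps_X)) *
              (fps_map of_rat_q (exp_q q) oo
                 (fps_const ((1 - v) \<div> (1 + u * v)) * fps_X)) in
        Abs_fps (\<lambda>n. if n = 0 then 0 else
              P_inv_pk_des n (of_rat_q q) y t * of_rat_q (1 / qfact q n)) =
        fps_const ((v * (1 + u)) \<div> (1 + u * v)) * ((F - 1) \<div> (1 - fps_const v * F)))"
  unfolding Let_def
  using inv_pk_des_gf_rational[OF qfact_q_rat_nonzero rat_denominators_nonzero] inv_pk_des_gf_series
  by (rule conjI)

end
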